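(* Let $\lambda>-\frac12$, $\lambda\neq 0$, let $1<p<\infty$, and let $w$ be a non-negative measurable function on $\mathbb{R}_+$. Then $w\in\widetilde A_{p,\lambda}$ if and only if there is a constant $C>0$ such that $\|\mathcal{M}_\lambda f\|_{L^p(\mathbb{R}_+,w)}\le C\|f\|_{L^p(\mathbb{R}_+,w)}$ for all $f\in L^p(\mathbb{R}_+,w)$.
   Context: $\mathbb{R}_+=(0,\infty)$. Intervals $B\subset\mathbb{R}_+$ are intervals $B=(a,b)$ with $0\le a<b<\infty$. $d\nu_\lambda(t)=t^{2\lambda+1}dt$ and $\nu_\lambda(B)=\int_B t^{2\lambda+1}dt$. $p'=p/(p-1)$. The norm is $\|f\|_{L^p(\mathbb{R}_+,w)}=\big(\int_{\mathbb{R}_+}|f(x)|^pw(x)\,dx\big)^{1/p}$ ($dx$ Lebesgue measure). The $\lambda$-maximal function is $\mathcal{M}_\lambda f(x)=\sup_{B\ni x}\frac1{\nu_\lambda(B)}\int_B|f(y)|\,d\nu_\lambda(y)$, the supremum being over intervals $B\subset\mathbb{R}_+$ containing $x$. The class $\widetilde A_{p,\lambda}$ consists of the non-negative measurable $w$ for which there is $C>0$ such that for all intervals $B\subset\mathbb{R}_+$, $$\Big(\frac1{\nu_\lambda(B)}\int_Bw(t)\,dt\Big)\Big(\frac1{\nu_\lambda(B)}\int_Bt^{(2\lambda+1)p'}w(t)^{-\frac1{p-1}}\,dt\Big)^{p-1}<C.$$ *)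

theory Defs
  imports "HOL-Analysis.Analysis"
begin

text \<open>
  All integrals are Lebesgue integrals of non-negative functions with values in \<open>[0,\<infinity>]\<close>, with the
  usual convention \<open>0 \<cdot> \<infinity> = 0\<close>. Lebesgue measure on \<open>(0,\<infinity>)\<close> is \<^term>\<open>lebesgue_on {0<..}\<close>, so measurable
  means Lebesgue measurable. Values of functions outside \<open>(0,\<infinity>)\<close> play no role.
\<close>

text \<open>
  Real powers of elements of \<open>[0,\<infinity>]\<close>. The values at \<open>0\<close> and \<open>\<infinity>\<close> are the limits, so that a
  negative power of \<open>0\<close> is \<open>\<infinity>\<close>; this differs from \<^const>\<open>powr\<close> on the reals, where
  \<open>0 powr a = 0\<close>.
\<close>
definition ennpowr :: "ennreal \<Rightarrow> real \<Rightarrow> ennreal" where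
  "ennpowr x a =
    (if a = 0 then 1
     else if x = 0 then (if a < 0 then top else 0)
     else if x = top then (if a < 0 then 0 else top)
     else ennreal (enn2real x powr a))"

definition conj_exponent :: "real \<Rightarrow> real" where
  "conj_exponent p = p / (p - 1)"

definition intervals :: "real set set" where
  "intervals = {{a<..<b} | a b. 0 \<le> a \<and> a < b}"

definition nu :: "real \<Rightarrow> real measure" where
  "nu l = density (lebesgue_on {0<..}) (\<lambda>t. ennreal (t powr (2 * l + 1)))"

definition maximal_fun :: "real \<Rightarrow> (real \<Rightarrow> real) \<Rightarrow> real \<Rightarrow> ennreal" where
  "maximal_fun l f x =
    (SUP B \<in> {B \<in> intervals. x \<in> B}.
       (1 / emeasure (nu l) B) * (\<integral>\<^sup>+ y \<in> B. ennreal \<bar>f y\<bar> \<partial>nu l))"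

text \<open>The norm takes \<open>[0,\<infinity>]\<close>-valued arguments, since the maximal function may be infinite.\<close>
definition Lp_norm :: "real \<Rightarrow> (real \<Rightarrow> real) \<Rightarrow> (real \<Rightarrow> ennreal) \<Rightarrow> ennreal" where
  "Lp_norm p w g =
    ennpowr (\<integral>\<^sup>+ x. ennpowr (g x) p * ennreal (w x) \<partial>lebesgue_on {0<..}) (1 / p)"

definition Lp_space :: "real \<Rightarrow> (real \<Rightarrow> real) \<Rightarrow> (real \<Rightarrow> real) set" where
  "Lp_space p w =
    {f \<in> borel_measurable (lebesgue_on {0<..}). Lp_norm p w (\<lambda>x. ennreal \<bar>f x\<bar>) < top}"

definition A_tilde :: "real \<Rightarrow> real \<Rightarrow> (real \<Rightarrow> real) set" where
  "A_tilde p l =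
    {w \<in> borel_measurable (lebesgue_on {0<..}). (\<forall>t>0. 0 \<le> w t) \<and>
      (\<exists>C::real. C > 0 \<and> (\<forall>B\<in>intervals.
         ((1 / emeasure (nu l) B) * (\<integral>\<^sup>+ t \<in> B. ennreal (w t) \<partial>lebesgue_on {0<..})) *
         ennpowr
           ((1 / emeasure (nu l) B) *
            (\<integral>\<^sup>+ t \<in> B. ennreal (t powr ((2 * l + 1) * conj_exponent p)) *
               ennpowr (ennreal (w t)) (- (1 / (p - 1))) \<partial>lebesgue_on {0<..}))
           (p - 1)
         < ennreal C))}"

end

theory Submission
  imports Defs
begin

text \<open>
  Put \<open>v = t\<^bsup>2\<lambda>+1\<^esup>\<close> and let \<open>s = v\<^bsup>p'\<^esup> w\<^bsup>-1/(p-1)\<^esup>\<close> be the dual weight. In dimension one the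
  uncentered maximal operator \<open>M\<^sub>\<mu>\<close> of any measure \<open>\<mu>\<close> finite on intervals is bounded on every
  \<open>L\<^bsup>q\<^esup>(\<mu>)\<close>, \<open>q > 1\<close>, because a finite family of intervals has a subfamily with the same union
  and overlap at most two; no doubling is needed. Following Lerner, the \<open>A\<^sub>p\<close> condition gives the
  pointwise bound \<open>(M f)\<^bsup>p-1\<^esup> \<le> C M\<^sub>w(M\<^sub>s(f v/s)\<^bsup>p-1\<^esup> v/w)\<close>, so the boundedness of \<open>M\<^sub>w\<close> on
  \<open>L\<^bsup>p'\<^esup>(w)\<close> and of \<open>M\<^sub>s\<close> on \<open>L\<^bsup>p\<^esup>(s)\<close> suffices, without the open-endedness of \<open>A\<^sub>p\<close>. Conversely, test
  the bound on \<open>s/v\<close> restricted to \<open>B \<inter> {w \<ge> 1/n}\<close> and let \<open>n \<rightarrow> \<infinity>\<close>; if \<open>w\<close> vanishes on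
  a part of \<open>B\<close> of positive measure, the indicator of that part forces \<open>w = 0\<close> almost everywhere on \<open>B\<close>.
\<close>

section \<open>Powers on [0,\<infinity>] and the layer-cake integral of a power\<close>

lemma ennpowr_0 [simp]: "a > 0 \<Longrightarrow> ennpowr 0 a = 0"
  and ennpowr_top [simp]: "a > 0 \<Longrightarrow> ennpowr top a = top"
  and ennpowr_1 [simp]: "ennpowr x 1 = x"
  by (auto simp: ennpowr_def ennreal_enn2real_if)

lemma ennpowr_ennreal: "0 < r \<Longrightarrow> ennpowr (ennreal r) a = ennreal (r powr a)"
  by (auto simp: ennpowr_def)

lemma ennpowr_ennreal_nonneg: "0 \<le> r \<Longrightarrow> a > 0 \<Longrightarrow> ennpowr (ennreal r) a = ennreal (r powr a)"
  by (cases "r = 0") (auto simp: ennpowr_ennreal)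

lemma ennpowr_cases:
  obtains "x = 0" | "x = top" | r where "r > 0" "x = ennreal r"
  by (cases x) (metis ennreal_0 order_le_less)+

lemma ennpowr_mono: "x \<le> y \<Longrightarrow> a > 0 \<Longrightarrow> ennpowr x a \<le> ennpowr y a"
  by (cases x rule: ennpowr_cases; cases y rule: ennpowr_cases)
     (auto simp: ennpowr_ennreal ennreal_le_iff2 powr_mono2 top_unique)

lemma ennpowr_mult: "a > 0 \<Longrightarrow> ennpowr (x * y) a = ennpowr x a * ennpowr y a"
  by (cases x rule: ennpowr_cases; cases y rule: ennpowr_cases)
     (auto simp: ennpowr_ennreal ennreal_mult_top ennreal_top_mult powr_mult simp flip: ennreal_mult)

lemma ennpowr_ennpowr: "a > 0 \<Longrightarrow> b > 0 \<Longrightarrow> ennpowr (ennpowr x a) b = ennpowr x (a * b)"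
  by (cases x rule: ennpowr_cases) (auto simp: ennpowr_ennreal powr_powr)

lemma ennpowr_add: "a > 0 \<Longrightarrow> b > 0 \<Longrightarrow> ennpowr x (a + b) = ennpowr x a * ennpowr x b"
  by (cases x rule: ennpowr_cases) (auto simp: ennpowr_ennreal powr_add simp flip: ennreal_mult)

lemma ennpowr_eq_top_iff: "a > 0 \<Longrightarrow> ennpowr x a = top \<longleftrightarrow> x = top"
  by (cases x rule: ennpowr_cases) (auto simp: ennpowr_ennreal)

lemma ennpowr_eq_0_iff: "a > 0 \<Longrightarrow> ennpowr x a = 0 \<longleftrightarrow> x = 0"
  by (cases x rule: ennpowr_cases) (auto simp: ennpowr_ennreal)

lemma ennpowr_le_iff:
  assumes "a > 0"
  shows "ennpowr x a \<le> y \<longleftrightarrow> x \<le> ennpowr y (1 / a)"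
proof
  assume "ennpowr x a \<le> y"
  from ennpowr_mono[OF this, of "1 / a"] assms show "x \<le> ennpowr y (1 / a)"
    by (simp add: ennpowr_ennpowr)
next
  assume "x \<le> ennpowr y (1 / a)"
  from ennpowr_mono[OF this, of a] assms show "ennpowr x a \<le> y"
    by (simp add: ennpowr_ennpowr)
qed

text \<open>For a > 0 the power is an order isomorphism of [0,\<infinity>] whose inverse is the
  power 1/a. Such a map preserves all suprema, including the empty one, whose value 0 it
  fixes.\<close>

lemma ennpowr_SUP:
  assumes "a > 0"
  shows "ennpowr (SUP i\<in>I. f i) a = (SUP i\<in>I. ennpowr (f i) a)"
proof (rule antisym)
  show "ennpowr (SUP i\<in>I. f i) a \<le> (SUP i\<in>I. ennpowr (f i) a)"
    unfolding ennpowr_le_iff[OF assms]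
    by (intro SUP_least, subst ennpowr_le_iff[OF assms, symmetric]) (rule SUP_upper)
  show "(SUP i\<in>I. ennpowr (f i) a) \<le> ennpowr (SUP i\<in>I. f i) a"
    by (intro SUP_least ennpowr_mono SUP_upper assms)
qed

lemma measurable_ennpowr [measurable]:
  assumes [measurable]: "f \<in> borel_measurable M"
  shows "(\<lambda>x. ennpowr (f x) a) \<in> borel_measurable M"
  unfolding ennpowr_def by measurable

text \<open>This is the inner integral of the layer-cake formula. For finite y it is the elementary
  integral of t^(a-1), up to the two end points; a > 0 gives convergence at 0.\<close>

lemma nn_integral_powr_layer:
  assumes "a > 0"
  shows "(\<integral>\<^sup>+t. ennreal (t powr (a - 1)) * indicator {t. 0 < t \<and> ennreal t < y} t \<partial>lborel)
    = ennreal (1 / a) * ennpowr y a" (is "?I y = _")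
proof -
  have fin: "?I (ennreal r) = ennreal (1 / a * r powr a)" if "r \<ge> 0" for r
  proof -
    have "?I (ennreal r) = (\<integral>\<^sup>+t. ennreal (t powr (a - 1)) * indicator {0..r} t \<partial>lborel)"
    proof (intro nn_integral_cong_AE)
      show "AE t in lborel. ennreal (t powr (a - 1)) * indicator {t. 0 < t \<and> ennreal t < ennreal r} t
          = ennreal (t powr (a - 1)) * indicator {0..r} t"
        using AE_lborel_singleton[of 0] AE_lborel_singleton[of r]
        by eventually_elim (auto simp: indicator_def ennreal_less_iff)
    qed
    also have "\<dots> = ennreal (r powr (a - 1 + 1) / (a - 1 + 1))"
      using has_integral_powr_from_0[of "a - 1" r] that assms
      by (intro nn_integral_has_integral_lebesgue') auto
    finally show ?thesis by simp
  qed
  show ?thesis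
  proof (cases y)
    case (real r)
    then show ?thesis using fin[of r] assms
      by (simp add: ennpowr_ennreal_nonneg flip: ennreal_mult)
  next
    case top
    \<comment> \<open>At y = \<infinity> the integral exceeds every n: the level (a n)^(1/a) is
      chosen so that the finite case evaluates to exactly n.\<close>
    have "ennreal (real n) \<le> ?I y" for n
    proof -
      have "ennreal (real n) = ?I (ennreal ((a * n) powr (1 / a)))"
        using assms by (subst fin) (auto simp: powr_powr)
      also have "\<dots> \<le> ?I y"
        by (intro nn_integral_mono) (auto simp: indicator_def top)
      finally show ?thesis .
    qed
    then have "?I y = top"
      by (metis ennreal_Ex_less_of_nat ennreal_of_nat_eq_real_of_nat leD top.not_eq_extremum)
    then show ?thesis using top assms by (simp add: ennreal_mult_top)
  qed
qed

section \<open>Finite families of intervals with overlap at most two\<close>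

text \<open>Pick an interval reaching furthest to the left and one reaching furthest to the right.
  Both contain x, so together they fill everything between the extreme end points, and a remaining
  interval is redundant.\<close>

lemma three_intervals_subset_Un:
  fixes x :: "'a::linorder"
  assumes "A = {a1<..<b1}" "B = {a2<..<b2}" "C = {a3<..<b3}" "x \<in> A" "x \<in> B" "x \<in> C"
  shows "A \<subseteq> B \<union> C \<or> B \<subseteq> A \<union> C \<or> C \<subseteq> A \<union> B"
proof -
  \<comment> \<open>Points up to x lie in an interval that reaches at least as far left, points
    beyond x in one that reaches at least as far right.\<close>
  have *: "{u<..<v} \<subseteq> {u'<..<v'} \<union> {u''<..<v''}"
    if "u' \<le> u \<or> u'' \<le> u" "v \<le> v' \<or> v \<le> v''" "u' < x" "x < v'" "u'' < x" "x < v''"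
    for u v u' v' u'' v''
  proof
    fix y assume "y \<in> {u<..<v}"
    with that show "y \<in> {u'<..<v'} \<union> {u''<..<v''}"
      by (cases "y \<le> x") auto
  qed
  \<comment> \<open>By linearity of the order, one of the three intervals is matched or exceeded on
    each side by another of them.\<close>
  consider "(a2 \<le> a1 \<or> a3 \<le> a1) \<and> (b1 \<le> b2 \<or> b1 \<le> b3)" |
    "(a1 \<le> a2 \<or> a3 \<le> a2) \<and> (b2 \<le> b1 \<or> b2 \<le> b3)" |
    "(a1 \<le> a3 \<or> a2 \<le> a3) \<and> (b3 \<le> b1 \<or> b3 \<le> b2)"
    using linorder_linear[of a1 a2] linorder_linear[of a1 a3] linorder_linear[of a2 a3]
      linorder_linear[of b1 b2] linorder_linear[of b1 b3] linorder_linear[of b2 b3]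
    by argo
  then show ?thesis
  proof cases
    case 1
    then have "A \<subseteq> B \<union> C" using assms(4-6) unfolding assms(1-3) by (intro *) auto
    then show ?thesis ..
  next
    case 2
    then have "B \<subseteq> A \<union> C" using assms(4-6) unfolding assms(1-3) by (intro *) auto
    then show ?thesis by simp
  next
    case 3
    then have "C \<subseteq> A \<union> B" using assms(4-6) unfolding assms(1-3) by (intro *) auto
    then show ?thesis by simp
  qed
qed

text \<open>Take a subfamily with the same union and the fewest members. No member can then lie in
  the union of two others, whereas three members through one point would yield such a
  member.\<close>

lemma finite_intervals_overlap:
  fixes F :: "'a::linorder set set"
  assumes fin: "finite F" and int: "\<And>B. B \<in> F \<Longrightarrow> \<exists>a b. B = {a<..<b}"
  obtains G where "G \<subseteq> F" "\<Union>G = \<Union>F" "\<And>x. card {B\<in>G. x \<in> B} \<le> 2"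
proof -
  define P where "P G \<longleftrightarrow> G \<subseteq> F \<and> \<Union>G = \<Union>F" for G
  have "P F" by (simp add: P_def)
  then obtain G where G: "P G" "\<And>H. P H \<Longrightarrow> card G \<le> card H"
    using ex_has_least_nat[of P F card] by metis
  have finG: "finite G" using G(1) finite_subset[OF _ fin] by (auto simp: P_def)
  have noncover: False if "A \<in> G" "B \<in> G" "C \<in> G" "A \<noteq> C" "B \<noteq> C" "C \<subseteq> A \<union> B" for A B C
  proof -
    have "\<Union>(G - {C}) = \<Union>G"
    proof (intro antisym subsetI)
      fix y assume "y \<in> \<Union>G"
      then obtain D where "D \<in> G" "y \<in> D" by blast
      with that show "y \<in> \<Union>(G - {C})" by (cases "D = C") auto
    qed auto
    then have "P (G - {C})" using G(1) by (auto simp: P_def)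
    then have "card G \<le> card (G - {C})" by (rule G(2))
    then show False using card_Diff1_less[OF finG that(3)] by simp
  qed
  have "card {B\<in>G. x \<in> B} \<le> 2" for x
  proof (rule ccontr)
    assume "\<not> card {B\<in>G. x \<in> B} \<le> 2"
    then have "3 \<le> card {B\<in>G. x \<in> B}" by simp
    then obtain T where T: "T \<subseteq> {B\<in>G. x \<in> B}" "card T = 3"
      by (meson obtain_subset_with_card_n)
    then obtain A B C where ABC: "T = {A, B, C}" "A \<noteq> B" "B \<noteq> C" "A \<noteq> C"
      by (auto simp: card_3_iff)
    have sub: "A \<in> G" "B \<in> G" "C \<in> G" "x \<in> A" "x \<in> B" "x \<in> C" using T ABC by auto
    have "G \<subseteq> F" using G(1) by (simp add: P_def)
    then have "A \<in> F" "B \<in> F" "C \<in> F" using sub(1-3) by auto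
    from this[THEN int] obtain a1 b1 a2 b2 a3 b3
      where "A = {a1<..<b1}" "B = {a2<..<b2}" "C = {a3<..<b3}" by auto
    then have "A \<subseteq> B \<union> C \<or> B \<subseteq> A \<union> C \<or> C \<subseteq> A \<union> B"
      using sub(4-6) by (rule three_intervals_subset_Un)
    then show False
      using noncover[of B C A] noncover[of A C B] noncover[of A B C] sub(1-3) ABC(2-4) by auto
  qed
  with G(1) show ?thesis by (intro that[of G]) (auto simp: P_def)
qed

section \<open>Weak type of the uncentered maximal operator\<close>

text \<open>The measure is arbitrary and the argument is [0,\<infinity>]-valued because the proof
  uses the operator for \<open>nu l\<close>, w dt and s dt, and feeds one maximal function into
  another. For x \<le> 0 no interval competes and the value is 0.\<close>

definition maximal_op :: "real measure \<Rightarrow> (real \<Rightarrow> ennreal) \<Rightarrow> real \<Rightarrow> ennreal" where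
  "maximal_op \<mu> g x =
    (SUP B \<in> {B \<in> intervals. x \<in> B}. (1 / emeasure \<mu> B) * (\<integral>\<^sup>+ y \<in> B. g y \<partial>\<mu>))"

lemma intervals_open: "B \<in> intervals \<Longrightarrow> open B"
  and intervals_pos: "B \<in> intervals \<Longrightarrow> B \<subseteq> {0<..}"
  by (auto simp: intervals_def)

lemma borel_pos_sets: "S \<in> sets borel \<Longrightarrow> S \<subseteq> {0<..} \<Longrightarrow> S \<in> sets (lebesgue_on {0::real<..})"
  by (subst sets_restrict_space_iff) auto

lemma intervals_sets: "B \<in> intervals \<Longrightarrow> B \<in> sets (lebesgue_on {0<..})"
  by (simp add: borel_pos_sets intervals_open intervals_pos borel_open)

text \<open>A supremum above c has a witnessing interval, and since the operator is uncentered this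
  interval serves all of its points. Openness of the superlevel sets and Borel measurability follow
  from this.\<close>

lemma maximal_op_greater_eq:
  "{x. c < maximal_op \<mu> g x} =
    \<Union>{B \<in> intervals. c < (1 / emeasure \<mu> B) * (\<integral>\<^sup>+ y \<in> B. g y \<partial>\<mu>)}"
  by (auto simp: maximal_op_def less_SUP_iff)

lemma open_maximal_op_greater: "open {x. c < maximal_op \<mu> g x}"
  unfolding maximal_op_greater_eq by (auto intro: open_Union intervals_open)

lemma borel_measurable_maximal_op: "maximal_op \<mu> g \<in> borel_measurable borel"
  by (rule borel_measurableI_greater) (simp add: borel_open open_maximal_op_greater)

lemma measurable_maximal_op [measurable]:
  "maximal_op \<mu> g \<in> borel_measurable (lebesgue_on {0<..})"
  by (intro measurable_restrict_space1 measurable_completion)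
     (simp add: borel_measurable_maximal_op)

lemma ennreal_less_divide_imp_mult_le:
  fixes t m I :: ennreal
  assumes "t < (1 / m) * I"
  shows "t * m \<le> I"
\<comment> \<open>For m = 0 the left side is 0; for m = \<infinity> the factor 1/m is 0 and the
  assumption is contradictory.\<close>
proof (cases "m = 0 \<or> m = top")
  case True
  with assms show ?thesis by (auto simp: ennreal_top_mult)
next
  case False
  have "t * m \<le> (1 / m) * I * m" using assms by (intro mult_right_mono) auto
  also have "\<dots> = I * (m / m)" by (simp add: ennreal_divide_times mult.commute ennreal_times_divide)
  also have "\<dots> = I" using False by (simp add: ennreal_divide_self top.not_eq_extremum)
  finally show ?thesis .
qed

text \<open>After thinning F to overlap at most two, the integrals over the remaining intervals can
  be summed with every point counted at most twice, whence the constant 2.\<close>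

lemma maximal_op_weak_type_finite:
  assumes sets: "sets \<mu> = sets (lebesgue_on {0<..})"
    and g[measurable]: "g \<in> borel_measurable \<mu>"
    and fin: "finite F" and F: "\<And>B. B \<in> F \<Longrightarrow> B \<in> intervals \<and> t * emeasure \<mu> B \<le> (\<integral>\<^sup>+ y \<in> B. g y \<partial>\<mu>)"
  shows "t * emeasure \<mu> (\<Union>F) \<le> 2 * (\<integral>\<^sup>+ y. g y \<partial>\<mu>)"
proof -
  have "\<exists>a b. B = {a<..<b}" if "B \<in> F" for B
    using F[OF that] by (auto simp: intervals_def)
  with fin obtain G where G: "G \<subseteq> F" "\<Union>G = \<Union>F" "\<And>x. card {B\<in>G. x \<in> B} \<le> 2"
    using finite_intervals_overlap by metis
  have finG: "finite G" using G(1) fin finite_subset by blast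
  have s[measurable]: "B \<in> sets \<mu>" if "B \<in> G" for B
    using F G(1) that sets intervals_sets by auto
  have "t * emeasure \<mu> (\<Union>F) \<le> t * (\<Sum>B\<in>G. emeasure \<mu> B)"
    unfolding G(2)[symmetric] using emeasure_subadditive_finite[OF finG, of "\<lambda>B. B" \<mu>]
    by (intro mult_left_mono) (auto intro: s)
  also have "\<dots> \<le> (\<Sum>B\<in>G. \<integral>\<^sup>+ y \<in> B. g y \<partial>\<mu>)"
    unfolding sum_distrib_left using F G(1) by (intro sum_mono) auto
  also have "\<dots> = (\<integral>\<^sup>+ y. (\<Sum>B\<in>G. g y * indicator B y) \<partial>\<mu>)"
    by (rule nn_integral_sum[symmetric]) auto
  also have "\<dots> \<le> (\<integral>\<^sup>+ y. 2 * g y \<partial>\<mu>)"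
  proof (rule nn_integral_mono)
    fix y
    have "(\<Sum>B\<in>G. g y * indicator B y) = g y * (\<Sum>B\<in>G. if y \<in> B then 1 else 0)"
      by (simp add: sum_distrib_left indicator_def of_bool_def)
    also have "(\<Sum>B\<in>G. if y \<in> B then 1 else 0 :: ennreal) = of_nat (card {B\<in>G. y \<in> B})"
      using finG by (simp flip: sum.inter_filter)
    also have "g y * of_nat (card {B\<in>G. y \<in> B}) \<le> g y * of_nat 2"
      using G(3)[of y] by (intro mult_left_mono of_nat_mono) auto
    finally show "(\<Sum>B\<in>G. g y * indicator B y) \<le> 2 * g y" by (simp add: mult.commute)
  qed
  also have "\<dots> = 2 * (\<integral>\<^sup>+ y. g y \<partial>\<mu>)" by (simp add: nn_integral_cmult)
  finally show ?thesis .
qed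

text \<open>The superlevel set is a union of open intervals. Lindelof reduces it to countably many,
  and continuity from below to finite subfamilies, for which the bound is uniform.\<close>

lemma maximal_op_weak_type:
  assumes sets: "sets \<mu> = sets (lebesgue_on {0<..})"
    and g[measurable]: "g \<in> borel_measurable \<mu>"
  shows "t * emeasure \<mu> {x. t < maximal_op \<mu> g x} \<le> 2 * (\<integral>\<^sup>+ y. g y \<partial>\<mu>)"
proof -
  define \<B> where "\<B> = {B \<in> intervals. t < (1 / emeasure \<mu> B) * (\<integral>\<^sup>+ y \<in> B. g y \<partial>\<mu>)}"
  have "open B" if "B \<in> \<B>" for B using that intervals_open by (auto simp: \<B>_def)
  then obtain \<C> where \<C>: "\<C> \<subseteq> \<B>" "countable \<C>" "\<Union>\<C> = \<Union>\<B>"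
    using Lindelof by metis
  show ?thesis
  proof (cases "\<C> = {}")
    case True
    then show ?thesis unfolding maximal_op_greater_eq \<B>_def[symmetric] \<C>(3)[symmetric] by simp
  next
    case False
    define A where "A n = \<Union>(from_nat_into \<C> ` {..<n})" for n :: nat
    have mem: "from_nat_into \<C> n \<in> \<B>" for n
      using from_nat_into[OF False] \<C>(1) by blast
    have "\<Union>\<B> = (\<Union>n. A n)"
      unfolding \<C>(3)[symmetric] A_def
      by (subst range_from_nat_into[OF False \<C>(2), symmetric]) (auto intro: lessI)
    moreover have "incseq A" unfolding A_def by (intro monoI Union_mono image_mono) auto
    moreover have "A n \<in> sets \<mu>" for n
      using mem sets intervals_sets unfolding A_def \<B>_def by auto
    ultimately have "emeasure \<mu> (\<Union>\<B>) = (SUP n. emeasure \<mu> (A n))"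
      by (simp add: SUP_emeasure_incseq image_subset_iff)
    moreover have "t * emeasure \<mu> (A n) \<le> 2 * (\<integral>\<^sup>+ y. g y \<partial>\<mu>)" for n
      unfolding A_def using mem
      by (intro maximal_op_weak_type_finite[OF sets g])
         (auto simp: \<B>_def intro: ennreal_less_divide_imp_mult_le)
    ultimately show ?thesis
      unfolding maximal_op_greater_eq \<B>_def[symmetric]
      by (simp add: SUP_mult_left_ennreal SUP_le_iff)
  qed
qed

text \<open>With h equal to g on {g > t} and 0 elsewhere, g \<le> h + t and hence M g \<le> M h + t,
  so {M g > 2t} lies in {M h > t}. Unlike the plain weak type, this bound can be integrated in t to
  give the strong type.\<close>

lemma maximal_op_weak_type_truncated:
  assumes sets: "sets \<mu> = sets (lebesgue_on {0<..})"
    and g[measurable]: "g \<in> borel_measurable \<mu>"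
  shows "t * emeasure \<mu> {x. 2 * t < maximal_op \<mu> g x} \<le>
    2 * (\<integral>\<^sup>+ y. g y * indicator {y. t < g y} y \<partial>\<mu>)"
proof -
  define h where "h y = g y * indicator {y. t < g y} y" for y
  have [measurable]: "h \<in> borel_measurable \<mu>" unfolding h_def by measurable
  have le: "maximal_op \<mu> g x \<le> maximal_op \<mu> h x + t" for x
    unfolding maximal_op_def[of \<mu> g]
  proof (rule SUP_least)
    fix B assume "B \<in> {B \<in> intervals. x \<in> B}"
    then have B: "B \<in> intervals" "x \<in> B" by auto
    then have [measurable]: "B \<in> sets \<mu>" by (simp add: sets intervals_sets)
    have "(\<integral>\<^sup>+ y \<in> B. g y \<partial>\<mu>) \<le> (\<integral>\<^sup>+ y. h y * indicator B y + t * indicator B y \<partial>\<mu>)"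
      by (intro nn_integral_mono) (auto simp: h_def indicator_def)
    also have "\<dots> = (\<integral>\<^sup>+ y \<in> B. h y \<partial>\<mu>) + t * emeasure \<mu> B"
      by (subst nn_integral_add) (auto simp: nn_integral_cmult)
    finally have "(1 / emeasure \<mu> B) * (\<integral>\<^sup>+ y \<in> B. g y \<partial>\<mu>) \<le>
        (1 / emeasure \<mu> B) * ((\<integral>\<^sup>+ y \<in> B. h y \<partial>\<mu>) + t * emeasure \<mu> B)"
      by (rule mult_left_mono) simp
    also have "\<dots> = (1 / emeasure \<mu> B) * (\<integral>\<^sup>+ y \<in> B. h y \<partial>\<mu>) + t * (1 / emeasure \<mu> B * emeasure \<mu> B)"
      by (simp only: distrib_left mult.left_commute)
    also have "(1 / emeasure \<mu> B) * (\<integral>\<^sup>+ y \<in> B. h y \<partial>\<mu>) \<le> maximal_op \<mu> h x"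
      unfolding maximal_op_def using B by (intro SUP_upper) auto
    \<comment> \<open>Only an inequality: if the measure of B is 0 or \<infinity>, the product is
      0.\<close>
    also have "1 / emeasure \<mu> B * emeasure \<mu> B \<le> 1"
      by (cases "emeasure \<mu> B = 0 \<or> emeasure \<mu> B = top")
         (auto simp: ennreal_divide_times ennreal_divide_self top.not_eq_extremum)
    finally show "(1 / emeasure \<mu> B) * (\<integral>\<^sup>+ y \<in> B. g y \<partial>\<mu>) \<le> maximal_op \<mu> h x + t"
      by (simp add: add_mono mult_left_mono)
  qed
  have "{x. 2 * t < maximal_op \<mu> g x} \<subseteq> {x. t < maximal_op \<mu> h x}"
  proof (intro subsetI CollectI)
    fix x assume "x \<in> {x. 2 * t < maximal_op \<mu> g x}"
    then have "t + t < maximal_op \<mu> h x + t"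
      using le[of x] by (simp only: mem_Collect_eq mult_2 order_less_le_trans)
    then show "t < maximal_op \<mu> h x"
      using add_right_mono[of "maximal_op \<mu> h x" t t] by (meson leD leI)
  qed
  moreover have "{x. t < maximal_op \<mu> h x} \<in> sets \<mu>"
    unfolding sets
    by (intro borel_pos_sets borel_open open_maximal_op_greater)
       (auto simp: maximal_op_greater_eq dest: intervals_pos)
  ultimately have "t * emeasure \<mu> {x. 2 * t < maximal_op \<mu> g x} \<le> t * emeasure \<mu> {x. t < maximal_op \<mu> h x}"
    by (intro mult_left_mono emeasure_mono) auto
  also have "\<dots> \<le> 2 * (\<integral>\<^sup>+ y. h y \<partial>\<mu>)"
    by (rule maximal_op_weak_type[OF sets]) measurable
  finally show ?thesis unfolding h_def .
qed

section \<open>Strong type via the layer-cake formula\<close>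

lemma sigma_finite_intervals:
  assumes sets: "sets \<mu> = sets (lebesgue_on {0<..})"
    and fin: "\<And>B. B \<in> intervals \<Longrightarrow> emeasure \<mu> B < top"
  shows "sigma_finite_measure \<mu>"
proof
  define A where "A = range (\<lambda>n::nat. {0<..<real (Suc n)})"
  have int: "B \<in> intervals" if "B \<in> A" for B
    using that unfolding A_def intervals_def by force
  have "countable A" by (simp add: A_def)
  moreover have "A \<subseteq> sets \<mu>" using int sets intervals_sets by auto
  moreover have "\<Union>A = space \<mu>"
  proof -
    have "\<exists>n. x < real (Suc n)" for x :: real
      using reals_Archimedean2[of x] by (meson less_Suc_eq of_nat_less_iff order_less_trans)
    then show ?thesis
      using sets_eq_imp_space_eq[OF sets] by (auto simp: A_def)
  qed
  moreover have "\<forall>a\<in>A. emeasure \<mu> a \<noteq> \<infinity>" using int fin by (auto simp: less_top)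
  ultimately show "\<exists>A. countable A \<and> A \<subseteq> sets \<mu> \<and> \<Union>A = space \<mu> \<and> (\<forall>a\<in>A. emeasure \<mu> a \<noteq> \<infinity>)"
    by blast
qed

text \<open>The factor k allows two uses: with k = 1 the formula expands the norm of the maximal
  function, and with k = g it collapses the truncated integrals of the weak-type bound back into a
  power. Sigma-finiteness is there for Tonelli.\<close>

lemma nn_integral_ennpowr_layer:
  assumes sf: "sigma_finite_measure \<mu>" and a: "a > 0"
    and [measurable]: "f \<in> borel_measurable \<mu>" "k \<in> borel_measurable \<mu>"
  shows "(\<integral>\<^sup>+x. k x * ennpowr (f x) a \<partial>\<mu>) =
    ennreal a * (\<integral>\<^sup>+t. ennreal (t powr (a - 1)) * indicator {0<..} t *
      (\<integral>\<^sup>+x. k x * indicator {x. ennreal t < f x} x \<partial>\<mu>) \<partial>lborel)"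
proof -
  interpret sigma_finite_measure \<mu> by fact
  interpret pair_sigma_finite lborel \<mu> ..
  have "k x * ennpowr (f x) a = (\<integral>\<^sup>+t. ennreal a *
      (ennreal (t powr (a - 1)) * indicator {0<..} t * (k x * indicator {x. ennreal t < f x} x)) \<partial>lborel)" for x
  proof -
    have "(\<integral>\<^sup>+t. ennreal a *
        (ennreal (t powr (a - 1)) * indicator {0<..} t * (k x * indicator {x. ennreal t < f x} x)) \<partial>lborel) =
      (\<integral>\<^sup>+t. (ennreal a * k x) *
        (ennreal (t powr (a - 1)) * indicator {t. 0 < t \<and> ennreal t < f x} t) \<partial>lborel)"
      by (intro nn_integral_cong) (simp add: indicator_def mult_ac)
    also have "\<dots> = ennreal a * k x * (ennreal (1 / a) * ennpowr (f x) a)"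
      by (subst nn_integral_cmult) (simp_all add: nn_integral_powr_layer[OF a])
    also have "\<dots> = (ennreal a * ennreal (1 / a)) * (k x * ennpowr (f x) a)"
      by (simp only: mult_ac)
    also have "ennreal a * ennreal (1 / a) = 1"
      using a by (simp flip: ennreal_mult)
    finally show ?thesis by simp
  qed
  then have "(\<integral>\<^sup>+x. k x * ennpowr (f x) a \<partial>\<mu>) = (\<integral>\<^sup>+x. (\<integral>\<^sup>+t. ennreal a * 
      (ennreal (t powr (a - 1)) * indicator {0<..} t *
      (k x * indicator {x. ennreal t < f x} x)) \<partial>lborel) \<partial>\<mu>)"
    by simp
  also have "\<dots> = (\<integral>\<^sup>+t. (\<integral>\<^sup>+x. ennreal a * 
      (ennreal (t powr (a - 1)) * indicator {0<..} t *
      (k x * indicator {x. ennreal t < f x} x)) \<partial>\<mu>) \<partial>lborel)"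
    by (rule Fubini') measurable
  also have "\<dots> = ennreal a * (\<integral>\<^sup>+t. ennreal (t powr (a - 1)) * indicator {0<..} t *
      (\<integral>\<^sup>+x. k x * indicator {x. ennreal t < f x} x \<partial>\<mu>) \<partial>lborel)"
    by (simp add: nn_integral_cmult)
  finally show ?thesis .
qed

text \<open>This is Marcinkiewicz interpolation carried out by hand. In the constant, q comes from
  the layer-cake formula, 4 from the weak type and the halved height, and 2^(q-1)/(q-1) from
  integrating t^(q-2) up to 2g, which converges at 0 because q > 1.\<close>

lemma maximal_op_strong_type:
  assumes sets: "sets \<mu> = sets (lebesgue_on {0<..})"
    and fin: "\<And>B. B \<in> intervals \<Longrightarrow> emeasure \<mu> B < top"
    and g[measurable]: "g \<in> borel_measurable \<mu>" and q: "1 < q"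
  shows "(\<integral>\<^sup>+x. ennpowr (maximal_op \<mu> g x) q \<partial>\<mu>) \<le>
    ennreal (q / (q - 1) * 2 powr (q + 1)) * (\<integral>\<^sup>+x. ennpowr (g x) q \<partial>\<mu>)"
proof -
  have sf: "sigma_finite_measure \<mu>" by (rule sigma_finite_intervals[OF sets fin])
  have [measurable]: "maximal_op \<mu> g \<in> borel_measurable \<mu>"
    by (simp add: measurable_maximal_op cong: measurable_cong_sets[OF sets refl])
  define E where "E t = {x. ennreal t < maximal_op \<mu> g x}" for t
  have Esets: "E t \<in> sets \<mu>" for t
    unfolding sets E_def
    by (intro borel_pos_sets borel_open open_maximal_op_greater)
       (auto simp: maximal_op_greater_eq dest: intervals_pos)
  have "(\<integral>\<^sup>+x. ennpowr (maximal_op \<mu> g x) q \<partial>\<mu>) = (\<integral>\<^sup>+x. 1 * ennpowr (maximal_op \<mu> g x) q \<partial>\<mu>)"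
    by simp
  also have "\<dots> = ennreal q * (\<integral>\<^sup>+t. ennreal (t powr (q - 1)) * indicator {0<..} t *
      (\<integral>\<^sup>+x. 1 * indicator (E t) x \<partial>\<mu>) \<partial>lborel)"
    unfolding E_def using q by (intro nn_integral_ennpowr_layer[OF sf]) auto
  also have "\<dots> \<le> ennreal q * (\<integral>\<^sup>+t. 4 * (ennreal (t powr (q - 1 - 1)) * indicator {0<..} t *
      (\<integral>\<^sup>+x. g x * indicator {x. ennreal t < 2 * g x} x \<partial>\<mu>)) \<partial>lborel)"
  proof (intro mult_left_mono nn_integral_mono)
    fix t :: real
    show "ennreal (t powr (q - 1)) * indicator {0<..} t * (\<integral>\<^sup>+x. 1 * indicator (E t) x \<partial>\<mu>) \<le>
      4 * (ennreal (t powr (q - 1 - 1)) * indicator {0<..} t *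
      (\<integral>\<^sup>+x. g x * indicator {x. ennreal t < 2 * g x} x \<partial>\<mu>))"
    proof (cases "t > 0")
      case True
      have half: "2 * ennreal (t / 2) = ennreal t"
        using True by (simp flip: ennreal_numeral ennreal_mult)
      have iff: "ennreal (t / 2) < y \<longleftrightarrow> ennreal t < 2 * y" for y
      proof (cases y)
        case (real r)
        then have "2 * y = ennreal (2 * r)" by (simp add: ennreal_mult)
        with real True show ?thesis by (auto simp: ennreal_less_iff)
      qed (simp add: ennreal_mult_top)
      \<comment> \<open>One power of t is split off as 2 (t/2), where t/2 is the height at which the
        truncated bound controls {M g > t}.\<close>
      have "ennreal (t powr (q - 1)) * emeasure \<mu> (E t)
        = 2 * ennreal (t powr (q - 1 - 1)) * (ennreal (t / 2) * emeasure \<mu> (E t))"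
      proof -
        have "t powr (q - 1) = 2 * t powr (q - 1 - 1) * (t / 2)"
          using True by (simp add: powr_diff power2_eq_square)
        then have "ennreal (t powr (q - 1)) = 2 * ennreal (t powr (q - 1 - 1)) * ennreal (t / 2)"
          using True by (simp flip: ennreal_mult ennreal_numeral)
        then show ?thesis by (simp only: mult.assoc)
      qed
      also have "\<dots> \<le> 2 * ennreal (t powr (q - 1 - 1)) *
          (2 * (\<integral>\<^sup>+x. g x * indicator {x. ennreal (t / 2) < g x} x \<partial>\<mu>))"
        using maximal_op_weak_type_truncated[OF sets g, of "ennreal (t / 2)"]
        unfolding half E_def by (intro mult_left_mono) auto
      also have "\<dots> = 4 * (ennreal (t powr (q - 1 - 1)) *
          (\<integral>\<^sup>+x. g x * indicator {x. ennreal t < 2 * g x} x \<partial>\<mu>))"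
        unfolding iff by (simp add: ac_simps)
      finally show ?thesis using True Esets by simp
    qed simp
  qed simp
  \<comment> \<open>The factor q - 1 is inserted because the integral is then the layer-cake
    expression for (2g)^(q-1) with weight g.\<close>
  also have "\<dots> = ennreal (4 * q / (q - 1)) * (ennreal (q - 1) * (\<integral>\<^sup>+t. ennreal (t powr (q - 1 - 1)) * indicator {0<..} t *
      (\<integral>\<^sup>+x. g x * indicator {x. ennreal t < 2 * g x} x \<partial>\<mu>) \<partial>lborel))"
  proof -
    interpret sigma_finite_measure \<mu> by fact
    have "4 * ennreal q = ennreal (4 * q / (q - 1)) * ennreal (q - 1)"
      using q by (simp flip: ennreal_mult ennreal_numeral)
    then show ?thesis
      by (subst nn_integral_cmult) (simp_all only: mult.assoc[symmetric] mult.commute[of "ennreal q" 4], measurable)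
  qed
  also have "\<dots> = ennreal (4 * q / (q - 1)) * (\<integral>\<^sup>+x. g x * ennpowr (2 * g x) (q - 1) \<partial>\<mu>)"
    using q by (subst nn_integral_ennpowr_layer[OF sf]) auto
  also have "\<dots> = ennreal (4 * q / (q - 1)) * (\<integral>\<^sup>+x. ennreal (2 powr (q - 1)) * ennpowr (g x) q \<partial>\<mu>)"
  proof -
    have "g x * ennpowr (2 * g x) (q - 1) = ennreal (2 powr (q - 1)) * ennpowr (g x) q" for x
      using q ennpowr_add[of 1 "q - 1" "g x"] ennpowr_ennreal[of 2 "q - 1"]
      by (simp add: ennpowr_mult ac_simps)
    then show ?thesis by simp
  qed
  also have "\<dots> = ennreal (4 * q / (q - 1) * 2 powr (q - 1)) * (\<integral>\<^sup>+x. ennpowr (g x) q \<partial>\<mu>)"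
  proof -
    have "ennreal (4 * q / (q - 1) * 2 powr (q - 1)) = ennreal (4 * q / (q - 1)) * ennreal (2 powr (q - 1))"
      using q by (intro ennreal_mult) auto
    then show ?thesis by (subst nn_integral_cmult) (measurable, simp only: mult.assoc)
  qed
  also have "4 * q / (q - 1) * 2 powr (q - 1) = q / (q - 1) * 2 powr (q + 1)"
  proof -
    have "2 powr (q + 1) = 2 powr (q - 1) * 4" using powr_add[of 2 "q - 1" 2] by (simp add: add.commute)
    then show ?thesis by simp
  qed
  finally show ?thesis .
qed

section \<open>Integrals over intervals, the measure \<open>nu\<close>, and iterated maximal
  functions\<close>

abbreviation (input) L :: "real measure" where "L \<equiv> lebesgue_on {0<..}"

lemma measurable_powr_L [measurable]: "(\<lambda>t. t powr a) \<in> borel_measurable L"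
  by (intro measurable_restrict_space1 measurable_completion) simp

lemma emeasure_L_interval: 
  assumes "0 \<le> a" "a < b"
  shows "emeasure L {a<..<b} = ennreal (b - a)"
proof -
  have "{a<..<b} \<subseteq> {0<..}" using assms by auto
  then show ?thesis using assms by (simp add: emeasure_restrict_space)
qed

lemma emeasure_L_pos: "B \<in> intervals \<Longrightarrow> emeasure L B > 0"
  by (auto simp: intervals_def emeasure_L_interval)

lemma nn_integral_interval_pos:
  assumes B: "B \<in> intervals" and [measurable]: "g \<in> borel_measurable L"
    and pos: "AE t in L. 0 < g t"
  shows "0 < (\<integral>\<^sup>+ t \<in> B. g t \<partial>L)"
proof -
  have [measurable]: "B \<in> sets L" by (rule intervals_sets[OF B])
  have "(\<integral>\<^sup>+ t \<in> B. g t \<partial>L) \<noteq> 0"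
  proof
    assume "(\<integral>\<^sup>+ t \<in> B. g t \<partial>L) = 0"
    then have "AE t in L. g t * indicator B t = 0" by (subst (asm) nn_integral_0_iff_AE) auto
    with pos have "AE t in L. t \<notin> B" by eventually_elim (auto simp: indicator_def split: if_splits)
    then have "emeasure L B = 0"
      by (subst (asm) AE_iff_measurable[of B]) (use B in \<open>auto dest: intervals_pos\<close>)
    with emeasure_L_pos[OF B] show False by simp
  qed
  then show ?thesis by (simp add: zero_less_iff_neq_zero)
qed

lemma emeasure_nu:
  assumes "B \<in> intervals"
  shows "emeasure (nu l) B = (\<integral>\<^sup>+ t \<in> B. ennreal (t powr (2 * l + 1)) \<partial>L)"
  unfolding nu_def using intervals_sets[OF assms] by (simp add: emeasure_density)

lemma emeasure_nu_pos: "B \<in> intervals \<Longrightarrow> 0 < emeasure (nu l) B"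
  unfolding emeasure_nu by (intro nn_integral_interval_pos) (auto intro!: AE_I2)

lemma emeasure_nu_finite:
  assumes "l > - 1 / 2" "B \<in> intervals"
  shows "emeasure (nu l) B < top"
proof -
  obtain a b where B: "B = {a<..<b}" "0 \<le> a" "a < b" using assms(2) by (auto simp: intervals_def)
  \<comment> \<open>As 2l + 1 > 0, the density is increasing and bounded on B by its value at
    b.\<close>
  have "emeasure (nu l) B \<le> (\<integral>\<^sup>+ t. ennreal (b powr (2 * l + 1)) * indicator B t \<partial>L)"
    unfolding emeasure_nu[OF assms(2)] using assms(1) B
    by (intro nn_integral_mono) (auto simp: indicator_def powr_mono2)
  also have "\<dots> = ennreal (b powr (2 * l + 1)) * emeasure L B"
    using intervals_sets[OF assms(2)] by (simp add: nn_integral_cmult_indicator)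
  also have "\<dots> < top"
    using B by (simp add: emeasure_L_interval flip: ennreal_mult)
  finally show ?thesis .
qed

lemma one_divide_mult_cancel: "y \<noteq> 0 \<Longrightarrow> y < top \<Longrightarrow> (1 / y) * (x * y) = x" for x y :: ennreal
  by (simp only: ennreal_divide_times mult_1_left) (simp add: mult_divide_eq_ennreal)

lemma maximal_fun_eq: "maximal_fun l f = maximal_op (nu l) (\<lambda>y. ennreal \<bar>f y\<bar>)"
  by (simp add: fun_eq_iff maximal_fun_def maximal_op_def)

text \<open>Taking p-th powers removes the outer roots, so that both directions of the theorem work
  with plain integrals.\<close>

lemma Lp_norm_le_iff:
  assumes "p > 0" "C > 0"
  shows "Lp_norm p w g \<le> ennreal C * Lp_norm p w h \<longleftrightarrow>
    (\<integral>\<^sup>+ x. ennpowr (g x) p * ennreal (w x) \<partial>L) \<le>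
      ennreal (C powr p) * (\<integral>\<^sup>+ x. ennpowr (h x) p * ennreal (w x) \<partial>L)"
  unfolding Lp_norm_def using assms
  by (simp add: ennpowr_le_iff ennpowr_mult ennpowr_ennpowr ennpowr_ennreal)

text \<open>
  Both averages of the \<open>A\<^sub>p\<close> product are spent: the average of \<open>s\<close> turns the average of \<open>f\<close> into one
  with respect to \<open>s dt\<close>, and the average of \<open>w\<close> does the same for the average of
  \<open>(M\<^sub>s \<phi>)\<^bsup>p-1\<^esup>\<close>.
\<close>
lemma maximal_op_le_iterated:
  assumes [measurable]: "v \<in> borel_measurable L" "w \<in> borel_measurable L" "s \<in> borel_measurable L"
      "f \<in> borel_measurable L" "\<phi> \<in> borel_measurable L" "h \<in> borel_measurable L"
    and r: "r > 0"
    and \<phi>: "AE t in L. f t * v t = \<phi> t * s t"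
    and h: "AE t in L. h t * w t = ennpowr (maximal_op (density L s) \<phi> t) r * v t"
    and fin: "\<And>B u. B \<in> intervals \<Longrightarrow> u \<in> {v, w, s} \<Longrightarrow>
      0 < emeasure (density L u) B \<and> emeasure (density L u) B < top"
    and C: "\<And>B. B \<in> intervals \<Longrightarrow> (1 / emeasure (density L v) B * emeasure (density L w) B) *
      ennpowr (1 / emeasure (density L v) B * emeasure (density L s) B) r \<le> C"
  shows "ennpowr (maximal_op (density L v) f x) r \<le> C * maximal_op (density L w) h x"
  unfolding maximal_op_def[of "density L v" f] ennpowr_SUP[OF r]
proof (rule SUP_least)
  fix B assume "B \<in> {B \<in> intervals. x \<in> B}"
  then have B: "B \<in> intervals" "x \<in> B" by auto
  have [measurable]: "B \<in> sets L" by (rule intervals_sets[OF B(1)])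
  define N W S where "N = emeasure (density L v) B" and "W = emeasure (density L w) B"
    and "S = emeasure (density L s) B"
  have pos: "N \<noteq> 0" "W \<noteq> 0" "S \<noteq> 0" "N < top" "W < top" "S < top"
    using fin[OF B(1)] by (auto simp: N_def W_def S_def zero_less_iff_neq_zero)
  define F where "F = (\<integral>\<^sup>+ y \<in> B. f y \<partial>density L v)"
  define m where "m = ennpowr ((1 / S) * F) r"
  have F: "F = (\<integral>\<^sup>+ y \<in> B. \<phi> y \<partial>density L s)"
  proof -
    have "F = (\<integral>\<^sup>+ y. f y * v y * indicator B y \<partial>L)"
      unfolding F_def by (simp add: nn_integral_density mult_ac)
    also have "\<dots> = (\<integral>\<^sup>+ y. \<phi> y * s y * indicator B y \<partial>L)"
      by (intro nn_integral_cong_AE) (use \<phi> in eventually_elim, simp)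
    also have "\<dots> = (\<integral>\<^sup>+ y \<in> B. \<phi> y \<partial>density L s)"
      by (simp add: nn_integral_density mult_ac)
    finally show ?thesis .
  qed
  \<comment> \<open>B itself competes in the supremum at each of its points, so the constant m may
    be replaced under an integral over B by the function (M_s \<phi>)^r.\<close>
  have m_le: "m \<le> ennpowr (maximal_op (density L s) \<phi> y) r" if "y \<in> B" for y
    unfolding m_def F S_def maximal_op_def
    by (intro ennpowr_mono SUP_upper r) (use B that in auto)
  have "m * N = (\<integral>\<^sup>+ y. m * (v y * indicator B y) \<partial>L)"
    unfolding N_def by (simp add: emeasure_density nn_integral_cmult)
  also have "\<dots> \<le> (\<integral>\<^sup>+ y. ennpowr (maximal_op (density L s) \<phi> y) r * v y * indicator B y \<partial>L)"
    by (intro nn_integral_mono) (auto simp: indicator_def intro!: mult_right_mono m_le)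
  also have "\<dots> = (\<integral>\<^sup>+ y. h y * w y * indicator B y \<partial>L)"
    by (intro nn_integral_cong_AE) (use h in eventually_elim, simp)
  also have "\<dots> = (\<integral>\<^sup>+ y \<in> B. h y \<partial>density L w)"
    by (simp add: nn_integral_density mult_ac)
  \<comment> \<open>Dividing and multiplying by W produces an average over B with respect to w dt,
    which M_w h dominates at x.\<close>
  also have "\<dots> = W * ((1 / W) * (\<integral>\<^sup>+ y \<in> B. h y \<partial>density L w))"
    by (subst mult.left_commute, subst mult.commute[of W])
       (simp only: one_divide_mult_cancel[OF pos(2) pos(5)])
  also have "\<dots> \<le> W * maximal_op (density L w) h x"
    unfolding maximal_op_def W_def by (intro mult_left_mono SUP_upper) (use B in auto)
  finally have "(1 / N) * (m * N) \<le> (1 / N) * (W * maximal_op (density L w) h x)"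
    by (rule mult_left_mono) simp
  then have m: "m \<le> (1 / N * W) * maximal_op (density L w) h x"
    by (simp only: one_divide_mult_cancel[OF pos(1) pos(4)] mult.assoc)
  \<comment> \<open>The v-average of f is the s-average of \<phi> times S/N; the r-th power of S/N
    joins W/N to form the product bounded by C.\<close>
  have "((1 / S) * F) * ((1 / N) * S) = (1 / N) * ((1 / S) * (F * S))"
    by (simp only: mult_ac)
  also have "\<dots> = (1 / N) * F" by (simp only: one_divide_mult_cancel[OF pos(3) pos(6)])
  finally have "(1 / N) * F = ((1 / S) * F) * ((1 / N) * S)" by (rule sym)
  then have "ennpowr ((1 / N) * F) r = m * ennpowr ((1 / N) * S) r"
    by (simp add: ennpowr_mult r m_def)
  also have "\<dots> \<le> (1 / N * W) * maximal_op (density L w) h x * ennpowr ((1 / N) * S) r"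
    by (intro mult_right_mono m) simp
  also have "\<dots> = ((1 / N * W) * ennpowr ((1 / N) * S) r) * maximal_op (density L w) h x"
    by (simp only: mult_ac)
  also have "\<dots> \<le> C * maximal_op (density L w) h x"
    using C[OF B(1)] unfolding N_def W_def S_def by (intro mult_right_mono) auto
  finally show "ennpowr (1 / emeasure (density L v) B * (\<integral>\<^sup>+ y \<in> B. f y \<partial>density L v)) r
      \<le> C * maximal_op (density L w) h x"
    unfolding N_def F_def .
qed

section \<open>The dual weight and consequences of the A_p condition\<close>

text \<open>This is the weight s. For p > 1 it is \<infinity> at the zeros of w in the half-line, so
  that its integrability detects them.\<close>

definition dual_weight :: "real \<Rightarrow> real \<Rightarrow> (real \<Rightarrow> real) \<Rightarrow> real \<Rightarrow> ennreal" where
  "dual_weight p l w t =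
    ennreal (t powr ((2 * l + 1) * conj_exponent p)) * ennpowr (ennreal (w t)) (- (1 / (p - 1)))"

lemma measurable_dual_weight [measurable]:
  "w \<in> borel_measurable L \<Longrightarrow> dual_weight p l w \<in> borel_measurable L"
  unfolding dual_weight_def by measurable

lemma dual_weight_pos: "p > 1 \<Longrightarrow> t > 0 \<Longrightarrow> 0 < dual_weight p l w t"
  unfolding dual_weight_def
  by (cases "ennreal (w t)" rule: ennpowr_cases)
     (auto simp: ennpowr_def ennreal_mult_top ennreal_zero_less_mult_iff)

lemma dual_weight_eq:
  "w t > 0 \<Longrightarrow> dual_weight p l w t =
    ennreal (t powr ((2 * l + 1) * conj_exponent p) * w t powr (- (1 / (p - 1))))"
  unfolding dual_weight_def by (simp add: ennpowr_ennreal ennreal_mult)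

lemma dual_weight_eq_top: "p > 1 \<Longrightarrow> t > 0 \<Longrightarrow> w t = 0 \<Longrightarrow> dual_weight p l w t = top"
  unfolding dual_weight_def by (simp add: ennpowr_def ennreal_mult_top)

definition Ap_product :: "real \<Rightarrow> real \<Rightarrow> (real \<Rightarrow> real) \<Rightarrow> real set \<Rightarrow> ennreal" where
  "Ap_product p l w B =
    ((1 / emeasure (nu l) B) * (\<integral>\<^sup>+ t \<in> B. ennreal (w t) \<partial>L)) *
     ennpowr ((1 / emeasure (nu l) B) * (\<integral>\<^sup>+ t \<in> B. dual_weight p l w t \<partial>L)) (p - 1)"

lemma A_tilde_iff:
  assumes "w \<in> borel_measurable L" "\<forall>t>0. 0 \<le> w t"
  shows "w \<in> A_tilde p l \<longleftrightarrow> (\<exists>C>0. \<forall>B\<in>intervals. Ap_product p l w B < ennreal C)"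
  using assms by (simp add: A_tilde_def Ap_product_def dual_weight_def)

lemma AE_L_pos: "AE t in L. 0 < t"
  by (rule AE_I2) simp

lemma AE_L_all_intervals:
  assumes "\<And>n::nat. AE t in L. t \<in> {0<..<real (Suc n)} \<longrightarrow> P t"
  shows "AE t in L. P t"
proof -
  have "AE t in L. \<forall>n. t \<in> {0<..<real (Suc n)} \<longrightarrow> P t"
    using assms unfolding AE_all_countable by blast
  then show ?thesis
  proof (rule AE_mp, intro AE_I2 impI)
    fix t :: real assume t: "t \<in> space L" and *: "\<forall>n. t \<in> {0<..<real (Suc n)} \<longrightarrow> P t"
    obtain n where "t < real n" using reals_Archimedean2 by blast
    then have "t \<in> {0<..<real (Suc n)}" using t by simp
    with * show "P t" by blast
  qed
qed

text \<open>If w has nonzero integral over an interval, finiteness of the product makes the integral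
  of s finite there, hence w > 0 almost everywhere there. Intervals (0,n) with n large are all of
  this kind unless w = 0 almost everywhere. Since s is positive, the integral of w must be finite as
  well.\<close>

lemma Ap_nondegenerate:
  assumes l: "l > - 1 / 2" and p: "1 < p" and w[measurable]: "w \<in> borel_measurable L"
    and nn: "\<forall>t>0. 0 \<le> w t"
    and C: "\<forall>B\<in>intervals. Ap_product p l w B < ennreal C"
    and nz: "\<not> (AE t in L. w t = 0)"
  shows "AE t in L. 0 < w t"
    and "B \<in> intervals \<Longrightarrow> (\<integral>\<^sup>+ t \<in> B. ennreal (w t) \<partial>L) < top"
    and "B \<in> intervals \<Longrightarrow> (\<integral>\<^sup>+ t \<in> B. dual_weight p l w t \<partial>L) < top"
proof -
  have fin0: "(\<integral>\<^sup>+ t \<in> B. dual_weight p l w t \<partial>L) < top"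
    if B: "B \<in> intervals" and W: "(\<integral>\<^sup>+ t \<in> B. ennreal (w t) \<partial>L) \<noteq> 0" for B
  proof (rule ccontr)
    assume "\<not> (\<integral>\<^sup>+ t \<in> B. dual_weight p l w t \<partial>L) < top"
    then have "(\<integral>\<^sup>+ t \<in> B. dual_weight p l w t \<partial>L) = top"
      using top.not_eq_extremum by blast
    moreover have "1 / emeasure (nu l) B \<noteq> 0"
      using emeasure_nu_finite[OF l B] by (simp add: ennreal_divide_eq_0_iff)
    ultimately have "Ap_product p l w B = top"
      using W p unfolding Ap_product_def by (simp add: ennreal_mult_top)
    with bspec[OF C B] show False by simp
  qed
  define J where "J n = {0<..<real (Suc n)}" for n
  have J: "J n \<in> intervals" for n unfolding J_def intervals_def by force
  have Js[measurable]: "J n \<in> sets L" for n by (rule intervals_sets[OF J])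
  obtain k where k: "(\<integral>\<^sup>+ t \<in> J k. ennreal (w t) \<partial>L) \<noteq> 0"
  proof (rule ccontr)
    assume "\<not> thesis"
    with that have z: "(\<integral>\<^sup>+ t \<in> J n. ennreal (w t) \<partial>L) = 0" for n by blast
    have "AE t in L. t \<in> J n \<longrightarrow> w t = 0" for n
    proof -
      have "AE t in L. ennreal (w t) * indicator (J n) t = 0"
        using z[of n] by (subst (asm) nn_integral_0_iff_AE) auto
      then show ?thesis using AE_L_pos
        by eventually_elim (use nn in \<open>force simp: indicator_def ennreal_eq_0_iff\<close>)
    qed
    then have "AE t in L. w t = 0" unfolding J_def by (rule AE_L_all_intervals)
    with nz show False by simp
  qed
  \<comment> \<open>On the larger of the two intervals w still has nonzero integral; finiteness then
    passes down to \<open>J n\<close>.\<close>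
  have big: "(\<integral>\<^sup>+ t \<in> J n. dual_weight p l w t \<partial>L) < top" for n
  proof -
    have "(\<integral>\<^sup>+ t \<in> J k. ennreal (w t) \<partial>L) \<le> (\<integral>\<^sup>+ t \<in> J (max n k). ennreal (w t) \<partial>L)"
      by (intro nn_integral_mono) (auto simp: indicator_def J_def)
    with k have "(\<integral>\<^sup>+ t \<in> J (max n k). ennreal (w t) \<partial>L) \<noteq> 0" by auto
    then have "(\<integral>\<^sup>+ t \<in> J (max n k). dual_weight p l w t \<partial>L) < top" using fin0 J by blast
    moreover have "(\<integral>\<^sup>+ t \<in> J n. dual_weight p l w t \<partial>L) \<le> (\<integral>\<^sup>+ t \<in> J (max n k). dual_weight p l w t \<partial>L)"
      by (intro nn_integral_mono) (auto simp: indicator_def J_def)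
    ultimately show ?thesis by (rule le_less_trans[rotated])
  qed
  have "AE t in L. t \<in> J n \<longrightarrow> 0 < w t" for n
  proof -
    have "AE t in L. dual_weight p l w t * indicator (J n) t \<noteq> top"
      using big[of n] by (intro nn_integral_PInf_AE[unfolded infinity_ennreal_def]) (auto simp: less_top)
    then show ?thesis using AE_L_pos
    proof eventually_elim
      case (elim t)
      then show ?case
        using nn[rule_format, of t] dual_weight_eq_top[OF p, of t w l]
        by (cases "w t = 0") (auto simp: indicator_def)
    qed
  qed
  then show pos: "AE t in L. 0 < w t" unfolding J_def by (rule AE_L_all_intervals)
  assume B: "B \<in> intervals"
  obtain n where "B \<subseteq> J n"
  proof -
    obtain a b where "B = {a<..<b}" "0 \<le> a" using B by (auto simp: intervals_def)
    moreover obtain n where "b < real n" using reals_Archimedean2 by blast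
    ultimately have "B \<subseteq> J n" by (auto simp: J_def)
    then show ?thesis by (rule that)
  qed
  then have "(\<integral>\<^sup>+ t \<in> B. dual_weight p l w t \<partial>L) \<le> (\<integral>\<^sup>+ t \<in> J n. dual_weight p l w t \<partial>L)"
    by (intro nn_integral_mono) (auto simp: indicator_def)
  with big[of n] show "(\<integral>\<^sup>+ t \<in> B. dual_weight p l w t \<partial>L) < top" by simp
  have "1 / emeasure (nu l) B \<noteq> 0"
    using emeasure_nu_finite[OF l B] by (simp add: ennreal_divide_eq_0_iff)
  moreover have "0 < (\<integral>\<^sup>+ t \<in> B. dual_weight p l w t \<partial>L)"
    using AE_L_pos by (intro nn_integral_interval_pos B) (auto elim!: eventually_mono dual_weight_pos[OF p])
  ultimately have "ennpowr ((1 / emeasure (nu l) B) * (\<integral>\<^sup>+ t \<in> B. dual_weight p l w t \<partial>L)) (p - 1) \<noteq> 0"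
    using p by (auto simp: ennpowr_eq_0_iff)
  then have "Ap_product p l w B = top" if "(\<integral>\<^sup>+ t \<in> B. ennreal (w t) \<partial>L) = top"
    using that \<open>1 / emeasure (nu l) B \<noteq> 0\<close> unfolding Ap_product_def
    by (simp only: ennreal_mult_top ennreal_top_mult if_False)
  then show "(\<integral>\<^sup>+ t \<in> B. ennreal (w t) \<partial>L) < top"
    using bspec[OF C B] by (metis top.not_eq_extremum top.extremum_strict)
qed

section \<open>From the A_p condition to the norm inequality\<close>

lemma conj_exponent_gt_1: "p > 1 \<Longrightarrow> 1 < conj_exponent p"
  and conj_exponent_mult: "p > 1 \<Longrightarrow> (p - 1) * conj_exponent p = p"
  and conj_exponent_minus_1: "p > 1 \<Longrightarrow> conj_exponent p - 1 = 1 / (p - 1)"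
  by (auto simp: conj_exponent_def field_simps)

text \<open>These identities link the two strong-type bounds. With V = v, y = w and S = s, the first
  turns the L^p'(w) norm of (M_s \<phi>)^(p-1) v/w into an L^p(s) norm of M_s \<phi>, and the second
  turns the L^p(s) norm of f v/s into the L^p(w) norm of f.\<close>

lemma dual_weight_identities:
  fixes a p t y :: real
  assumes p: "p > 1" and t: "t > 0" and y: "y > 0"
  defines "V \<equiv> t powr a" and "S \<equiv> t powr (a * conj_exponent p) * y powr (- (1 / (p - 1)))"
  shows "(V / y) powr conj_exponent p * y = S"
    and "(V / S) powr p * S = y"
proof -
  let ?q = "conj_exponent p"
  have V: "V > 0" and S: "S > 0" using t y by (auto simp: V_def S_def)
  have "(V / y) powr ?q * y = V powr ?q * y powr (1 - ?q)"
    using V y by (simp add: powr_divide powr_diff)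
  also have "\<dots> = S"
    using conj_exponent_minus_1[OF p] unfolding V_def S_def
    by (simp add: powr_powr minus_equation_iff[of "1 / (p - 1)"] algebra_simps)
  finally show "(V / y) powr ?q * y = S" .
  have "S powr (1 - p) = t powr (a * (?q * (1 - p))) * y powr (- (1 / (p - 1)) * (1 - p))"
    unfolding S_def using t y by (simp add: powr_mult powr_powr mult.assoc)
  also have "?q * (1 - p) = - p" using conj_exponent_mult[OF p] by (simp add: algebra_simps)
  also have "- (1 / (p - 1)) * (1 - p) = 1" using p by (simp add: field_simps)
  finally have S': "S powr (1 - p) = t powr (- (a * p)) * y" using y by simp
  have "(V / S) powr p * S = V powr p * S powr (1 - p)"
    using V S by (simp add: powr_divide powr_diff)
  also have "\<dots> = y" unfolding S' V_def using t by (simp add: powr_powr flip: powr_add mult.assoc)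
  finally show "(V / S) powr p * S = y" .
qed

text \<open>The pointwise bound raised to the power p' contributes C^p'; the strong type of M_w with
  exponent p' and of M_s with exponent p contribute the two values of k.\<close>

lemma Ap_imp_maximal_fun_bounded:
  assumes l: "l > - 1 / 2" and p: "1 < p" and w[measurable]: "w \<in> borel_measurable L"
    and nn: "\<forall>t>0. 0 \<le> w t"
    and C0: "C > 0" and C: "\<And>B. B \<in> intervals \<Longrightarrow> Ap_product p l w B < ennreal C"
    and f[measurable]: "f \<in> borel_measurable L"
  defines "k \<equiv> \<lambda>q. q / (q - 1) * 2 powr (q + 1)"
  shows "(\<integral>\<^sup>+ x. ennpowr (maximal_fun l f x) p * ennreal (w x) \<partial>L) \<le>
    ennreal (C powr conj_exponent p * k (conj_exponent p) * k p) *
      (\<integral>\<^sup>+ x. ennpowr (ennreal \<bar>f x\<bar>) p * ennreal (w x) \<partial>L)"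
\<comment> \<open>A weight vanishing almost everywhere makes the left side 0; every other one is
  nondegenerate.\<close>
proof (cases "AE t in L. w t = 0")
  case True
  have "(\<integral>\<^sup>+ x. ennpowr (maximal_fun l f x) p * ennreal (w x) \<partial>L) = (\<integral>\<^sup>+ x. 0 \<partial>L)"
    by (intro nn_integral_cong_AE) (use True in eventually_elim, simp)
  then show ?thesis by simp
next
  case False
  have "\<forall>B\<in>intervals. Ap_product p l w B < ennreal C" using C by blast
  note nd = Ap_nondegenerate[OF l p w nn this False]
  let ?q = "conj_exponent p"
  note q = conj_exponent_gt_1[OF p]
  define v where "v t = ennreal (t powr (2 * l + 1))" for t
  define w' where "w' t = ennreal (w t)" for t
  define s where "s = dual_weight p l w"
  \<comment> \<open>A real-valued copy of s, equal to it where w > 0, so that the quotient v/s can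
    be formed in the reals.\<close>
  define sR where "sR t = t powr ((2 * l + 1) * ?q) * w t powr (- (1 / (p - 1)))" for t
  define \<phi> where "\<phi> t = ennreal \<bar>f t\<bar> * ennreal (t powr (2 * l + 1) / sR t)" for t
  define Ms where "Ms = maximal_op (density L s) \<phi>"
  define h where "h t = ennpowr (Ms t) (p - 1) * ennreal (t powr (2 * l + 1) / w t)" for t
  define Mh where "Mh = maximal_op (density L w') h"
  have [measurable]: "v \<in> borel_measurable L" "w' \<in> borel_measurable L" "s \<in> borel_measurable L"
      "sR \<in> borel_measurable L"
    unfolding v_def w'_def s_def sR_def by measurable
  have [measurable]: "\<phi> \<in> borel_measurable L" "Ms \<in> borel_measurable L"
    unfolding \<phi>_def Ms_def by measurable
  have [measurable]: "h \<in> borel_measurable L" "Mh \<in> borel_measurable L"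
    unfolding h_def Mh_def by measurable
  have v: "nu l = density L v" by (simp add: nu_def v_def[abs_def])
  have s_eq: "AE t in L. 0 < t \<and> 0 < w t \<and> 0 < sR t \<and> s t = ennreal (sR t)"
    using nd(1) AE_L_pos by eventually_elim (simp add: s_def sR_def dual_weight_eq)
  have fin: "0 < emeasure (density L u) B \<and> emeasure (density L u) B < top"
    if B: "B \<in> intervals" and u: "u \<in> {v, w', s}" for B u
  proof -
    have Bs: "B \<in> sets L" by (rule intervals_sets[OF B])
    have um: "u \<in> borel_measurable L" using u by auto
    have "AE t in L. 0 < u t"
      using nd(1) AE_L_pos
      by eventually_elim (use u dual_weight_pos[OF p] in \<open>auto simp: v_def w'_def s_def\<close>)
    from nn_integral_interval_pos[OF B um this] have "0 < emeasure (density L u) B"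
      using um Bs by (simp add: emeasure_density)
    moreover have "emeasure (density L u) B < top"
      using u emeasure_nu_finite[OF l B] nd(2,3)[OF B] Bs
      by (auto simp: v emeasure_density w'_def[abs_def] s_def)
    ultimately show ?thesis ..
  qed
  have point: "ennpowr (maximal_fun l f x) (p - 1) \<le> ennreal C * Mh x" for x
    unfolding maximal_fun_eq v Mh_def
  proof (rule maximal_op_le_iterated[where s = s and \<phi> = \<phi>])
    show "AE t in L. ennreal \<bar>f t\<bar> * v t = \<phi> t * s t"
      using s_eq
    proof eventually_elim
      case (elim t)
      then have "ennreal (t powr (2 * l + 1) / sR t) * ennreal (sR t) = v t"
        by (simp add: v_def flip: ennreal_mult)
      then show ?case using elim by (simp add: \<phi>_def mult.assoc)
    qed
    show "AE t in L. h t * w' t = ennpowr (maximal_op (density L s) \<phi> t) (p - 1) * v t"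
      using s_eq
    proof eventually_elim
      case (elim t)
      then have "ennreal (t powr (2 * l + 1) / w t) * w' t = v t"
        by (simp add: v_def w'_def flip: ennreal_mult)
      then show ?case by (simp add: h_def Ms_def mult.assoc)
    qed
    show "1 / emeasure (density L v) B * emeasure (density L w') B *
        ennpowr (1 / emeasure (density L v) B * emeasure (density L s) B) (p - 1) \<le> ennreal C"
      if "B \<in> intervals" for B
      using C[OF that] intervals_sets[OF that]
      by (simp add: Ap_product_def v emeasure_density w'_def[abs_def] s_def)
  qed (use p fin in auto)
  \<comment> \<open>Here (p - 1) p' = p turns the power p - 1 of the pointwise bound into p.\<close>
  have M_le: "ennpowr (maximal_fun l f x) p \<le> ennreal (C powr ?q) * ennpowr (Mh x) ?q" for x
  proof -
    have "ennpowr (ennpowr (maximal_fun l f x) (p - 1)) ?q \<le> ennpowr (ennreal C * Mh x) ?q"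
      using q by (intro ennpowr_mono point) auto
    then show ?thesis
      using p q C0 by (simp add: ennpowr_ennpowr conj_exponent_mult ennpowr_mult ennpowr_ennreal)
  qed
  have "(\<integral>\<^sup>+ x. ennpowr (maximal_fun l f x) p * ennreal (w x) \<partial>L) \<le>
      (\<integral>\<^sup>+ x. ennreal (C powr ?q) * (w' x * ennpowr (Mh x) ?q) \<partial>L)"
  proof (rule nn_integral_mono)
    fix x
    show "ennpowr (maximal_fun l f x) p * ennreal (w x) \<le> ennreal (C powr ?q) * (w' x * ennpowr (Mh x) ?q)"
      using mult_right_mono[OF M_le[of x], of "w' x"] by (simp add: w'_def mult_ac)
  qed
  also have "\<dots> = ennreal (C powr ?q) * (\<integral>\<^sup>+ x. ennpowr (Mh x) ?q \<partial>density L w')"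
    by (simp add: nn_integral_cmult nn_integral_density)
  also have "(\<integral>\<^sup>+ x. ennpowr (Mh x) ?q \<partial>density L w') \<le> ennreal (k ?q) * (\<integral>\<^sup>+ x. ennpowr (h x) ?q \<partial>density L w')"
    unfolding Mh_def k_def using fin q by (intro maximal_op_strong_type) auto
  also have "(\<integral>\<^sup>+ x. ennpowr (h x) ?q \<partial>density L w') = (\<integral>\<^sup>+ x. w' x * ennpowr (h x) ?q \<partial>L)"
    by (simp add: nn_integral_density)
  also have "\<dots> = (\<integral>\<^sup>+ x. s x * ennpowr (Ms x) p \<partial>L)"
  proof (rule nn_integral_cong_AE, use s_eq in eventually_elim)
    case (elim t)
    have "ennpowr (ennreal (t powr (2 * l + 1) / w t)) ?q * w' t = s t"
      using elim dual_weight_identities(1)[OF p, of t "w t" "2 * l + 1"]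
      by (simp add: ennpowr_ennreal w'_def sR_def flip: ennreal_mult)
    moreover have "ennpowr (h t) ?q = ennpowr (Ms t) p * ennpowr (ennreal (t powr (2 * l + 1) / w t)) ?q"
      using p q by (simp add: h_def ennpowr_mult ennpowr_ennpowr conj_exponent_mult)
    ultimately show ?case by (metis mult.assoc mult.commute)
  qed
  also have "\<dots> = (\<integral>\<^sup>+ x. ennpowr (Ms x) p \<partial>density L s)"
    by (simp add: nn_integral_density)
  also have "\<dots> \<le> ennreal (k p) * (\<integral>\<^sup>+ x. ennpowr (\<phi> x) p \<partial>density L s)"
    unfolding Ms_def k_def using fin p by (intro maximal_op_strong_type) auto
  also have "(\<integral>\<^sup>+ x. ennpowr (\<phi> x) p \<partial>density L s) = (\<integral>\<^sup>+ x. s x * ennpowr (\<phi> x) p \<partial>L)"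
    by (simp add: nn_integral_density)
  also have "\<dots> = (\<integral>\<^sup>+ x. ennpowr (ennreal \<bar>f x\<bar>) p * ennreal (w x) \<partial>L)"
  proof (rule nn_integral_cong_AE, use s_eq in eventually_elim)
    case (elim t)
    have "ennpowr (ennreal (t powr (2 * l + 1) / sR t)) p * s t = ennreal (w t)"
      using elim dual_weight_identities(2)[OF p, of t "w t" "2 * l + 1"]
      by (simp add: ennpowr_ennreal sR_def flip: ennreal_mult)
    moreover have "ennpowr (\<phi> t) p = ennpowr (ennreal \<bar>f t\<bar>) p * ennpowr (ennreal (t powr (2 * l + 1) / sR t)) p"
      using p by (simp add: \<phi>_def ennpowr_mult)
    ultimately show ?case by (metis mult.assoc mult.commute)
  qed
  finally have "(\<integral>\<^sup>+ x. ennpowr (maximal_fun l f x) p * ennreal (w x) \<partial>L) \<le>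
      ennreal (C powr ?q) * (ennreal (k ?q) * (ennreal (k p) * 
        (\<integral>\<^sup>+ x. ennpowr (ennreal \<bar>f x\<bar>) p * ennreal (w x) \<partial>L)))"
    by (simp add: mult_left_mono)
  also have "\<dots> = ennreal (C powr ?q * k ?q * k p) * (\<integral>\<^sup>+ x. ennpowr (ennreal \<bar>f x\<bar>) p * ennreal (w x) \<partial>L)"
  proof -
    have "k ?q \<ge> 0" "k p \<ge> 0" using p q by (auto simp: k_def)
    then show ?thesis by (simp add: ennreal_mult mult.assoc)
  qed
  finally show ?thesis .
qed

section \<open>From the norm inequality to the A_p condition\<close>

text \<open>At every point of B the maximal function is at least the average over B, so restricting
  the left-hand norm to B leaves that constant times the integral of w.\<close>

lemma maximal_bound_tested:
  assumes p: "1 < p" and C0: "C > 0" and w[measurable]: "w \<in> borel_measurable L"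
    and bound: "\<forall>f \<in> Lp_space p w.
      Lp_norm p w (maximal_fun l f) \<le> ennreal C * Lp_norm p w (\<lambda>x. ennreal \<bar>f x\<bar>)"
    and B: "B \<in> intervals" and f[measurable]: "f \<in> borel_measurable L" and f0: "\<And>x. 0 \<le> f x"
    and fin: "(\<integral>\<^sup>+ x. ennpowr (ennreal (f x)) p * ennreal (w x) \<partial>L) < top"
  shows "ennpowr (1 / emeasure (nu l) B * (\<integral>\<^sup>+ x \<in> B. ennreal (f x * x powr (2 * l + 1)) \<partial>L)) p *
      (\<integral>\<^sup>+ x \<in> B. ennreal (w x) \<partial>L) \<le>
    ennreal (C powr p) * (\<integral>\<^sup>+ x. ennpowr (ennreal (f x)) p * ennreal (w x) \<partial>L)"
proof -
  have [measurable]: "B \<in> sets L" by (rule intervals_sets[OF B])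
  have fabs: "\<bar>f x\<bar> = f x" for x using f0[of x] by simp
  have "Lp_norm p w (\<lambda>x. ennreal (f x)) \<noteq> top"
    unfolding Lp_norm_def using p fin by (simp add: ennpowr_eq_top_iff)
  then have "f \<in> Lp_space p w"
    unfolding Lp_space_def using f by (simp add: fabs less_top)
  with bound have "Lp_norm p w (maximal_fun l f) \<le> ennreal C * Lp_norm p w (\<lambda>x. ennreal (f x))"
    by (auto simp: fabs)
  then have le: "(\<integral>\<^sup>+ x. ennpowr (maximal_fun l f x) p * ennreal (w x) \<partial>L) \<le>
      ennreal (C powr p) * (\<integral>\<^sup>+ x. ennpowr (ennreal (f x)) p * ennreal (w x) \<partial>L)"
    using p C0 by (simp add: Lp_norm_le_iff)
  have F: "(\<integral>\<^sup>+ x \<in> B. ennreal (f x) \<partial>nu l) = (\<integral>\<^sup>+ x \<in> B. ennreal (f x * x powr (2 * l + 1)) \<partial>L)"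
    unfolding nu_def using f0
    by (subst nn_integral_density) (auto intro!: nn_integral_cong simp: ennreal_mult mult_ac)
  let ?A = "1 / emeasure (nu l) B * (\<integral>\<^sup>+ x \<in> B. ennreal (f x * x powr (2 * l + 1)) \<partial>L)"
  have A_le: "?A \<le> maximal_fun l f x" if "x \<in> B" for x
    unfolding F[symmetric] maximal_fun_def fabs by (rule SUP_upper) (use B that in auto)
  have "ennpowr ?A p * (\<integral>\<^sup>+ x \<in> B. ennreal (w x) \<partial>L) = (\<integral>\<^sup>+ x. ennpowr ?A p * (ennreal (w x) * indicator B x) \<partial>L)"
    by (simp add: nn_integral_cmult)
  also have "\<dots> \<le> (\<integral>\<^sup>+ x. ennpowr (maximal_fun l f x) p * ennreal (w x) \<partial>L)"
    using p by (intro nn_integral_mono) (auto split: split_indicator intro!: mult_right_mono ennpowr_mono A_le)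
  also note le
  finally show ?thesis .
qed

text \<open>For f = s/v both f v and f^p w equal s, so the tested inequality contains the integral
  of s on both sides and yields the A_p product after division. The truncation to {w \<ge> c} makes
  this integral finite, as the division requires.\<close>

lemma maximal_fun_bounded_imp_Ap:
  assumes l: "l > - 1 / 2" and p: "1 < p" and C0: "C > 0" and w[measurable]: "w \<in> borel_measurable L"
    and nn: "\<forall>t>0. 0 \<le> w t"
    and bound: "\<forall>f \<in> Lp_space p w.
      Lp_norm p w (maximal_fun l f) \<le> ennreal C * Lp_norm p w (\<lambda>x. ennreal \<bar>f x\<bar>)"
    and B: "B \<in> intervals"
  shows "Ap_product p l w B \<le> ennreal (C powr p)"
proof -
  note tested = maximal_bound_tested[OF p C0 w bound B]
  have [measurable]: "B \<in> sets L" by (rule intervals_sets[OF B])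
  have Bpos: "t > 0" if "t \<in> B" for t using intervals_pos[OF B] that by auto
  define N where "N = emeasure (nu l) B"
  have N: "N \<noteq> 0" "N < top"
    using emeasure_nu_pos[OF B] emeasure_nu_finite[OF l B] by (auto simp: N_def zero_less_iff_neq_zero)
  have N': "1 / N \<noteq> 0" using N by (simp add: ennreal_divide_eq_0_iff)
  define W where "W = (\<integral>\<^sup>+ t \<in> B. ennreal (w t) \<partial>L)"
  show ?thesis
  proof (cases "AE t in L. t \<in> B \<longrightarrow> 0 < w t")
    case False
    \<comment> \<open>This f has norm 0 but positive average over B, which forces W = 0; the product
      is then 0 by the convention 0 \<cdot> \<infinity> = 0.\<close>
    define f where "f = (indicator (B \<inter> {t. w t = 0}) :: real \<Rightarrow> real)"
    have [measurable]: "f \<in> borel_measurable L"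
    proof -
      have "B \<inter> {t. w t = 0} = {t \<in> space L. t \<in> B \<and> w t = 0}" using Bpos by auto
      also have "\<dots> \<in> sets L" by measurable
      finally show ?thesis unfolding f_def by measurable
    qed
    have f0: "f x \<ge> 0" for x by (simp add: f_def)
    have z: "(\<integral>\<^sup>+ x. ennpowr (ennreal (f x)) p * ennreal (w x) \<partial>L) = 0"
    proof -
      have "(\<integral>\<^sup>+ x. ennpowr (ennreal (f x)) p * ennreal (w x) \<partial>L) = (\<integral>\<^sup>+ x. 0 \<partial>L)"
        using p by (intro nn_integral_cong) (auto simp: f_def indicator_def)
      then show ?thesis by simp
    qed
    have "(\<integral>\<^sup>+ x \<in> B. ennreal (f x * x powr (2 * l + 1)) \<partial>L) \<noteq> 0"
    proof
      assume "(\<integral>\<^sup>+ x \<in> B. ennreal (f x * x powr (2 * l + 1)) \<partial>L) = 0"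
      then have "AE x in L. ennreal (f x * x powr (2 * l + 1)) * indicator B x = 0"
        by (subst (asm) nn_integral_0_iff_AE) auto
      then have "AE t in L. t \<in> B \<longrightarrow> 0 < w t"
        using AE_L_pos
      proof eventually_elim
        case (elim t)
        then show ?case using nn[rule_format, of t]
          by (cases "w t = 0") (auto simp: f_def indicator_def ennreal_eq_0_iff split: if_splits)
      qed
      with False show False by simp
    qed
    then have "ennpowr (1 / N * (\<integral>\<^sup>+ x \<in> B. ennreal (f x * x powr (2 * l + 1)) \<partial>L)) p \<noteq> 0"
      using p N' by (simp add: ennpowr_eq_0_iff)
    moreover have "ennpowr (1 / N * (\<integral>\<^sup>+ x \<in> B. ennreal (f x * x powr (2 * l + 1)) \<partial>L)) p * W = 0"
      using tested[of f] f0 z by (simp add: N_def W_def)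
    ultimately have "W = 0" by simp
    then show ?thesis by (simp add: Ap_product_def W_def)
  next
    case True
    define s where "s = dual_weight p l w"
    have [measurable]: "s \<in> borel_measurable L" unfolding s_def by measurable
    define c where "c n = 1 / real (Suc n)" for n
    define E where "E n = {t \<in> B. c n \<le> w t}" for n
    have E[measurable]: "E n \<in> sets L" for n
    proof -
      have "E n = {t \<in> space L. t \<in> B \<and> c n \<le> w t}" using Bpos by (auto simp: E_def)
      also have "\<dots> \<in> sets L" by measurable
      finally show ?thesis .
    qed
    have c0: "c n > 0" for n by (simp add: c_def)
    define S where "S n = (\<integral>\<^sup>+ t \<in> E n. s t \<partial>L)" for n
    have Sfin: "S n < top" for n
    proof -
      obtain a b where ab: "B = {a<..<b}" "0 \<le> a" "a < b" using B by (auto simp: intervals_def)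
      \<comment> \<open>On \<open>E n\<close> the factor t^((2l+1)p') is at most its value at b, and
        the negative power of w is at most that of its lower bound \<open>c n\<close>.\<close>
      let ?K = "b powr ((2 * l + 1) * conj_exponent p) * c n powr (- (1 / (p - 1)))"
      have "s t \<le> ennreal ?K" if "t \<in> E n" for t
      proof -
        have t: "0 < t" "t < b" "c n \<le> w t" using that ab by (auto simp: E_def)
        have "t powr ((2 * l + 1) * conj_exponent p) \<le> b powr ((2 * l + 1) * conj_exponent p)"
          using t l conj_exponent_gt_1[OF p] by (intro powr_mono2) auto
        moreover have "w t powr (- (1 / (p - 1))) \<le> c n powr (- (1 / (p - 1)))"
          using t c0[of n] p by (intro powr_mono2') auto
        ultimately show ?thesis
          using t c0[of n] unfolding s_def by (subst dual_weight_eq) (auto intro!: ennreal_leI mult_mono)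
      qed
      then have "S n \<le> (\<integral>\<^sup>+ t. ennreal ?K * indicator B t \<partial>L)"
        unfolding S_def by (intro nn_integral_mono) (auto simp: indicator_def E_def)
      also have "\<dots> = ennreal ?K * emeasure L B" by (simp add: nn_integral_cmult_indicator)
      also have "\<dots> < top" using ab by (simp add: emeasure_L_interval flip: ennreal_mult)
      finally show ?thesis .
    qed
    have main: "(1 / N * W) * ennpowr (1 / N * S n) (p - 1) \<le> ennreal (C powr p)" for n
    proof (cases "S n = 0")
      case True
      then show ?thesis using p by simp
    next
      case False
      \<comment> \<open>This is s/v, since (2l+1) p' - (2l+1) = (2l+1)/(p-1).\<close>
      define u where "u t = t powr ((2 * l + 1) * (1 / (p - 1))) * w t powr (- (1 / (p - 1)))" for t
      define f where "f t = u t * indicator (E n) t" for t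
      have [measurable]: "f \<in> borel_measurable L" unfolding f_def u_def by measurable
      have f0: "f t \<ge> 0" for t by (simp add: f_def u_def)
      have u: "u t * t powr (2 * l + 1) = t powr ((2 * l + 1) * conj_exponent p) * w t powr (- (1 / (p - 1)))"
          "u t powr p * w t = t powr ((2 * l + 1) * conj_exponent p) * w t powr (- (1 / (p - 1)))"
          "s t = ennreal (t powr ((2 * l + 1) * conj_exponent p) * w t powr (- (1 / (p - 1))))" "u t > 0"
        if "t \<in> E n" for t
      proof -
        have t: "0 < t" "0 < w t" using that c0[of n] Bpos by (auto simp: E_def)
        have e: "(2 * l + 1) * conj_exponent p = (2 * l + 1) * (1 / (p - 1)) + (2 * l + 1)"
          using conj_exponent_minus_1[OF p] by (simp add: algebra_simps)
        show "u t * t powr (2 * l + 1) = t powr ((2 * l + 1) * conj_exponent p) * w t powr (- (1 / (p - 1)))"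
          unfolding u_def e powr_add[of t "(2 * l + 1) * (1 / (p - 1))"] by (rule mult.assoc[THEN trans]) simp
        have e2: "1 / (p - 1) * p = conj_exponent p" by (simp add: conj_exponent_def)
        have e3: "- (1 / (p - 1)) = - (1 / (p - 1)) * p + 1" using p by (simp add: field_simps)
        have "u t powr p * w t = t powr ((2 * l + 1) * (1 / (p - 1) * p)) * w t powr (- (1 / (p - 1)) * p + 1)"
          using t unfolding u_def powr_add by (simp add: powr_mult powr_powr mult.assoc)
        then show "u t powr p * w t = t powr ((2 * l + 1) * conj_exponent p) * w t powr (- (1 / (p - 1)))"
          unfolding e2 e3[symmetric] .
        show "s t = ennreal (t powr ((2 * l + 1) * conj_exponent p) * w t powr (- (1 / (p - 1))))"
          unfolding s_def using t by (rule_tac dual_weight_eq)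
        show "u t > 0" using t by (simp add: u_def)
      qed
      have Sp: "(\<integral>\<^sup>+ x. ennpowr (ennreal (f x)) p * ennreal (w x) \<partial>L) = S n"
        unfolding S_def
      proof (rule nn_integral_cong)
        fix t
        show "ennpowr (ennreal (f t)) p * ennreal (w t) = s t * indicator (E n) t"
        proof (cases "t \<in> E n")
          case True
          have "ennpowr (ennreal (f t)) p * ennreal (w t) = ennreal (u t powr p * w t)"
            using True u(4)[OF True] c0[of n] by (simp add: f_def ennpowr_ennreal ennreal_mult')
          with u(2,3)[OF True] True show ?thesis by simp
        qed (use p in \<open>simp add: f_def\<close>)
      qed
      have S1: "(\<integral>\<^sup>+ x \<in> B. ennreal (f x * x powr (2 * l + 1)) \<partial>L) = S n"
        unfolding S_def
      proof (rule nn_integral_cong)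
        fix t
        show "ennreal (f t * t powr (2 * l + 1)) * indicator B t = s t * indicator (E n) t"
        proof (cases "t \<in> E n")
          case True
          then have "t \<in> B" by (simp add: E_def)
          with u(1,3)[OF True] True show ?thesis by (simp add: f_def)
        qed (simp add: f_def)
      qed
      have "ennpowr (1 / N * S n) p * W \<le> ennreal (C powr p) * S n"
        using tested[of f] f0 Sp Sfin[of n] by (simp add: S1 N_def W_def)
      then have "(1 / S n) * (ennpowr (1 / N * S n) p * W) \<le> (1 / S n) * (ennreal (C powr p) * S n)"
        by (rule mult_left_mono) simp
      also have "\<dots> = ennreal (C powr p)" by (rule one_divide_mult_cancel[OF False Sfin])
      finally have *: "(1 / S n) * (ennpowr (1 / N * S n) p * W) \<le> ennreal (C powr p)" .
      \<comment> \<open>One factor S n/N is peeled off the p-th power: its S n cancels against 1/S n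
        and its 1/N joins W.\<close>
      have "ennpowr (1 / N * S n) p = ennpowr (1 / N * S n) (p - 1) * (1 / N * S n)"
        using ennpowr_add[of "p - 1" 1 "1 / N * S n"] p by simp
      then have "(1 / S n) * (ennpowr (1 / N * S n) p * W) =
          (1 / S n) * (((1 / N * W) * ennpowr (1 / N * S n) (p - 1)) * S n)"
        by (simp only: mult_ac)
      also have "\<dots> = (1 / N * W) * ennpowr (1 / N * S n) (p - 1)"
        by (rule one_divide_mult_cancel[OF False Sfin])
      finally show ?thesis using * by simp
    qed
    have "(\<integral>\<^sup>+ t \<in> B. s t \<partial>L) = (\<integral>\<^sup>+ t. (SUP n. s t * indicator (E n) t) \<partial>L)"
    \<comment> \<open>The sets \<open>E n\<close> exhaust B up to a null set, because w > 0 almost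
      everywhere on B.\<close>
    proof (rule nn_integral_cong_AE, use True in eventually_elim)
      case (elim t)
      show ?case
      proof (cases "t \<in> B")
        case True
        then obtain n where "c n < w t"
          using elim reals_Archimedean[of "w t"] by (auto simp: c_def inverse_eq_divide)
        then have "t \<in> E n" using True by (simp add: E_def)
        then have "s t \<le> (SUP n. s t * indicator (E n) t)"
          by (intro SUP_upper2[of n]) auto
        moreover have "(SUP n. s t * indicator (E n) t) \<le> s t"
          by (intro SUP_least) (simp add: indicator_def)
        ultimately show ?thesis using True by simp
      next
        case False
        then have "t \<notin> E n" for n by (simp add: E_def)
        with False show ?thesis by simp
      qed
    qed
    also have "\<dots> = (SUP n. S n)"
      unfolding S_def
    proof (rule nn_integral_monotone_convergence_SUP)
      have "c n \<le> c m" if "m \<le> n" for m n using that by (simp add: c_def frac_le)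
      then have "E m \<subseteq> E n" if "m \<le> n" for m n using that by (auto simp: E_def intro: order_trans)
      then show "incseq (\<lambda>n t. s t * indicator (E n) t)"
        by (auto simp: incseq_def le_fun_def indicator_def)
    qed measurable
    finally have "Ap_product p l w B = (SUP n. (1 / N * W) * ennpowr (1 / N * S n) (p - 1))"
      using p by (simp add: Ap_product_def N_def W_def s_def SUP_mult_left_ennreal ennpowr_SUP)
    also have "\<dots> \<le> ennreal (C powr p)" by (intro SUP_least main)
    finally show ?thesis .
  qed
qed

theorem theorem1p3:
  fixes l p :: real and w :: "real \<Rightarrow> real"
  assumes "l > - 1 / 2" and "l \<noteq> 0"
    and "1 < p"
    and "w \<in> borel_measurable (lebesgue_on {0<..})"
    and "\<forall>t>0. 0 \<le> w t"
  shows "w \<in> A_tilde p l \<longleftrightarrow>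
    (\<exists>C::real. C > 0 \<and> (\<forall>f \<in> Lp_space p w.
       Lp_norm p w (maximal_fun l f) \<le> ennreal C * Lp_norm p w (\<lambda>x. ennreal \<bar>f x\<bar>)))"
proof
  assume "w \<in> A_tilde p l"
  then obtain C where C: "C > 0" "\<And>B. B \<in> intervals \<Longrightarrow> Ap_product p l w B < ennreal C"
    unfolding A_tilde_iff[OF assms(4,5)] by blast
  let ?q = "conj_exponent p"
  \<comment> \<open>D is the constant for the integrals; its p-th root is the constant for the
    norms.\<close>
  define D where "D = C powr ?q * (?q / (?q - 1) * 2 powr (?q + 1)) * (p / (p - 1) * 2 powr (p + 1))"
  have D: "D > 0" using C(1) assms(3) conj_exponent_gt_1[OF assms(3)] by (auto simp: D_def)
  then have "(D powr (1 / p)) powr p = D" using assms(3) by (simp add: powr_powr)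
  moreover have "(\<integral>\<^sup>+ x. ennpowr (maximal_fun l f x) p * ennreal (w x) \<partial>lebesgue_on {0<..}) \<le>
      ennreal D * (\<integral>\<^sup>+ x. ennpowr (ennreal \<bar>f x\<bar>) p * ennreal (w x) \<partial>lebesgue_on {0<..})"
    if "f \<in> Lp_space p w" for f
    unfolding D_def using that by (intro Ap_imp_maximal_fun_bounded assms C) (auto simp: Lp_space_def)
  ultimately have "\<forall>f \<in> Lp_space p w.
       Lp_norm p w (maximal_fun l f) \<le> ennreal (D powr (1 / p)) * Lp_norm p w (\<lambda>x. ennreal \<bar>f x\<bar>)"
    using D assms(3) by (auto simp: Lp_norm_le_iff)
  then show "\<exists>C::real. C > 0 \<and> (\<forall>f \<in> Lp_space p w.
       Lp_norm p w (maximal_fun l f) \<le> ennreal C * Lp_norm p w (\<lambda>x. ennreal \<bar>f x\<bar>))"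
    using D by (intro exI[of _ "D powr (1 / p)"]) simp
next
  assume "\<exists>C::real. C > 0 \<and> (\<forall>f \<in> Lp_space p w.
       Lp_norm p w (maximal_fun l f) \<le> ennreal C * Lp_norm p w (\<lambda>x. ennreal \<bar>f x\<bar>))"
  then obtain C where "C > 0" "\<forall>f \<in> Lp_space p w.
       Lp_norm p w (maximal_fun l f) \<le> ennreal C * Lp_norm p w (\<lambda>x. ennreal \<bar>f x\<bar>)"
    by blast
  then have "Ap_product p l w B \<le> ennreal (C powr p)" if "B \<in> intervals" for B
    using that by (intro maximal_fun_bounded_imp_Ap assms)
  \<comment> \<open>The class demands a strict inequality, hence the added 1.\<close>
  then have "Ap_product p l w B < ennreal (C powr p + 1)" if "B \<in> intervals" for B
    by (rule le_less_trans[OF _ ennreal_lessI]) (use that in \<open>auto intro: add_nonneg_pos\<close>)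
  then show "w \<in> A_tilde p l"
    unfolding A_tilde_iff[OF assms(4,5)] by (intro exI[of _ "C powr p + 1"]) (auto intro: add_nonneg_pos)
qed

end
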